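(* For every $\pi\in\mathfrak{S}_n$, $$\sum_{j,k\ge 0}(j+1)\binom{(j+1)k+n-1-\mathrm{cdes}(\pi)}{n-1}s^jt^k=\frac{\sum_{\sigma\tau=\pi}s^{\mathrm{des}(\sigma)}t^{\mathrm{cdes}(\tau)}}{(1-s)^{n+1}(1-t)^n},$$ where the sum on the right is over all pairs $(\sigma,\tau)\in\mathfrak{S}_n\times\mathfrak{S}_n$ with $\sigma\tau=\pi$.
   Context: $\mathfrak{S}_n$ is the symmetric group of bijections of $\{1,\ldots,n\}$ with composition $(\sigma\tau)(i)=\sigma(\tau(i))$. For $\pi\in\mathfrak{S}_n$, $\mathrm{des}(\pi)$ is the number of $i\in\{1,\ldots,n-1\}$ with $\pi(i)>\pi(i+1)$, and the cyclic descent number $\mathrm{cdes}(\pi)$ is the number of $i\in\{1,\ldots,n\}$ with $\pi(i)>\pi(i+1)$, where $\pi(n+1):=\pi(1)$. The identity is one of formal power series in $s,t$. *)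

theory Defs
  imports
    "HOL-Combinatorics.Permutations"
    "HOL-Computational_Algebra.Formal_Power_Series"
begin

definition des :: "nat \<Rightarrow> (nat \<Rightarrow> nat) \<Rightarrow> nat" where
  "des n \<pi> = card {i \<in> {1..n - 1}. \<pi> i > \<pi> (i + 1)}"

definition cdes :: "nat \<Rightarrow> (nat \<Rightarrow> nat) \<Rightarrow> nat" where
  "cdes n \<pi> = card {i \<in> {1..n}. \<pi> i > (if i = n then \<pi> 1 else \<pi> (i + 1))}"

text \<open>
  Power series in two variables over the rationals are series in \<open>s\<close> whose coefficients are
  series in \<open>t\<close>; the coefficient of \<open>s ^ j * t ^ k\<close> in \<open>F\<close> is \<open>fps_nth (fps_nth F j) k\<close>.
\<close>

definition var_s :: "rat fps fps" where
  "var_s = fps_X"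

definition var_t :: "rat fps fps" where
  "var_t = fps_const fps_X"

definition fps2 :: "(nat \<Rightarrow> nat \<Rightarrow> rat) \<Rightarrow> rat fps fps" where
  "fps2 a = Abs_fps (\<lambda>j. Abs_fps (\<lambda>k. a j k))"

lemma monomial_eq_fps2:
  "var_s ^ j * var_t ^ k = fps2 (\<lambda>j' k'. if j' = j \<and> k' = k then 1 else 0)"
  by (intro fps_ext) (auto simp: var_s_def var_t_def fps2_def fps_X_power_iff)

text \<open>
  Since \<open>rat fps\<close> is not a field, division in \<open>rat fps fps\<close> needs some care. The following shows
  that it is the true quotient whenever the constant term of the denominator is a nonzero rational.
\<close>

lemma fps2_divide_eq_iff:
  fixes F G H :: "rat fps fps"
  assumes "fps_nth (fps_nth G 0) 0 \<noteq> 0"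
  shows "H = F / G \<longleftrightarrow> H * G = F"
proof -
  have "inverse (fps_nth G 0) * fps_nth G 0 = 1"
    using assms by (rule inverse_mult_eq_1)
  then have "G * fps_right_inverse G (inverse (fps_nth G 0)) = 1"
    by (intro fps_right_inverse) (simp add: mult.commute)
  then have inv: "G * inverse G = 1"
    by (simp add: fps_inverse_def)
  have "fps_nth G 0 \<noteq> 0"
    using assms by auto
  then have quot: "F / G = F * inverse G"
    by (rule fps_divide_unit)
  show ?thesis
  proof
    assume "H = F / G"
    then show "H * G = F"
      using inv by (simp add: quot mult.assoc mult.commute[of _ G])
  next
    assume "H * G = F"
    then have "F * inverse G = H * (G * inverse G)"
      by (simp add: mult.assoc)
    then show "H = F / G"
      by (simp add: quot inv)
  qed
qed

lemma denominator_constant_term: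
  "fps_nth (fps_nth ((1 - var_s) ^ a * (1 - var_t) ^ b) 0) 0 \<noteq> 0"
  by (simp add: var_s_def var_t_def fps_power_zeroth)

text \<open>This bound means that the natural number \<open>n - 1 - cdes n \<pi>\<close> is never truncated.\<close>

lemma cdes_le:
  assumes "\<pi> permutes {1..n}" and "n \<ge> 1"
  shows "cdes n \<pi> \<le> n - 1"
proof -
  obtain i where i: "i \<in> {1..n}" "\<pi> i = 1"
    using permutes_image[OF assms(1)] assms(2)
    by (metis atLeastAtMost_iff imageE order_refl)
  have "\<pi> k \<ge> 1" if "k \<in> {1..n}" for k
    using permutes_in_image[OF assms(1), of k] that by simp
  then have "\<pi> i \<le> (if i = n then \<pi> 1 else \<pi> (i + 1))"
    using i assms(2) by simp
  then have "{k \<in> {1..n}. \<pi> k > (if k = n then \<pi> 1 else \<pi> (k + 1))} \<subseteq> {1..n} - {i}"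
    by (auto split: if_splits simp del: One_nat_def)
  then have "cdes n \<pi> \<le> card ({1..n} - {i})"
    unfolding cdes_def by (intro card_mono) auto
  then show ?thesis
    using i by simp
qed

end

theory Submission
  imports Defs "HOL-Library.FuncSet"
begin

text \<open>
  In the group algebra let \<open>\<Phi>(m)\<close> be the sum of the stable sorting permutations of all words in
  \<open>{..<m}\<^sup>n\<close>. The coefficient of \<open>\<sigma>\<close> in \<open>\<Phi>(m)\<close> is \<open>(m + n - 1 - des \<sigma>) choose n\<close>, and radix sort gives
  \<open>\<Phi>(m) \<Phi>(k) = \<Phi>(m k)\<close>. Let \<open>C(k)\<close> be the element with coefficients
  \<open>(k + n - 1 - cdes \<tau>) choose (n - 1)\<close>. Among the \<open>n\<close> rotations of a permutation, each
  cyclic descent is broken once, so the sum \<open>\<Omega>\<close> of all rotations satisfies \<open>\<Phi>(k) \<Omega> = k C(k)\<close>.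
  Hence \<open>k \<Phi>(m) C(k) = \<Phi>(m k) \<Omega> = m k C(m k)\<close>, that is, \<open>\<Phi>(m) C(k) = m C(m k)\<close>, and with
  \<open>m = j + 1\<close> this is the claimed identity of coefficients, because
  \<open>\<Sum>j. ((j + n - c) choose n) s\<^sup>j = s\<^sup>c / (1 - s)\<^sup>n\<^sup>+\<^sup>1\<close>.
\<close>

section \<open>Chains of adjacent steps and increasing enumerations\<close>

text \<open>Lets sortedness and strict monotonicity be checked at neighbouring positions only, which
  is where descents live.\<close>

lemma adjacent_imp_all:
  fixes R :: "nat \<Rightarrow> nat \<Rightarrow> bool"
  assumes "transp R" and "\<And>i. a \<le> i \<Longrightarrow> i < b \<Longrightarrow> R i (i + 1)"
    and "a \<le> i" "i < j" "j \<le> b"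
  shows "R i j"
  using assms(4,3,5)
proof (induction j rule: less_induct)
  case (less j)
  then obtain l where l: "j = l + 1" "i \<le> l"
    by (metis Suc_eq_plus1 less_imp_Suc_add le_add1)
  show ?case
  proof (cases "i = l")
    case True
    then show ?thesis using assms(2)[of i] less.prems l by simp
  next
    case False
    then have "R i l" using less l by simp
    moreover have "R l (l + 1)" using assms(2)[of l] less.prems l by simp
    ultimately show ?thesis using assms(1) l by (auto dest: transpD)
  qed
qed

lemma strict_mono_enumeration:
  fixes A :: "nat set"
  assumes "finite A" "card A = n"
  obtains g where "strict_mono_on {1..n} g" "g ` {1..n} = A"
proof
  let ?xs = "sorted_list_of_set A" and ?g = "\<lambda>i. sorted_list_of_set A ! (i - 1)"
  have len: "length ?xs = n" using assms by simp
  have sorted: "sorted_wrt (<) ?xs" by simp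
  show "strict_mono_on {1..n} ?g"
  proof (rule strict_mono_onI)
    fix r s assume "r \<in> {1..n}" "s \<in> {1..n}" "r < s"
    then show "?g r < ?g s"
      using sorted_wrt_nth_less[OF sorted, of "r - 1" "s - 1"] len by auto
  qed
  have "?g ` {1..n} = (!) ?xs ` ((\<lambda>i. i - 1) ` {1..n})"
    by (simp add: image_image)
  also have "(\<lambda>i. i - 1) ` {1..n} = {..<n}"
  proof
    show "{..<n} \<subseteq> (\<lambda>i. i - 1) ` {1..n}"
    proof
      fix x assume "x \<in> {..<n}"
      then show "x \<in> (\<lambda>i. i - 1) ` {1..n}"
        by (intro image_eqI[of _ _ "Suc x"]) auto
    qed
  qed auto
  also have "(!) ?xs ` {..<n} = set ?xs"
    using len by (auto simp: set_conv_nth)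
  finally show "?g ` {1..n} = A" using assms by simp
qed

text \<open>The index of an element is determined by its rank in the common image.\<close>

lemma strict_mono_enumeration_unique:
  fixes g h :: "nat \<Rightarrow> nat"
  assumes "strict_mono_on {1..n} g" "strict_mono_on {1..n} h"
    and "g ` {1..n} = h ` {1..n}" "i \<in> {1..n}"
  shows "g i = h i"
proof -
  have rank: "card {x \<in> f ` {1..n}. x < f j} = j - 1"
    if f: "strict_mono_on {1..n} f" and j: "j \<in> {1..n}" for f :: "nat \<Rightarrow> nat" and j
  proof -
    have "{x \<in> f ` {1..n}. x < f j} = f ` {1..<j}"
      using strict_mono_on_less[OF f] j by auto
    moreover have "inj_on f {1..<j}"
      using strict_mono_on_imp_inj_on[OF f] j by (auto intro: inj_on_subset)
    ultimately show ?thesis by (simp add: card_image)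
  qed
  have "g i \<in> h ` {1..n}" using assms by blast
  then obtain j where j: "j \<in> {1..n}" "g i = h j" by auto
  have "i - 1 = j - 1"
    using rank[OF assms(1,4)] rank[OF assms(2) j(1)] assms(3) j(2) by simp
  moreover have "1 \<le> i" "1 \<le> j" using assms(4) j(1) by auto
  ultimately have "i = j" by linarith
  then show ?thesis using j(2) by simp
qed

text \<open>An increasing function is determined by its image, an \<open>n\<close>-subset of
  \<open>{..<M}\<close>, and every such subset has an increasing enumeration.\<close>

lemma card_strict_mono_functions:
  "card {g \<in> {1..n} \<rightarrow>\<^sub>E {..<M}. strict_mono_on {1..n} (g :: nat \<Rightarrow> nat)} = M choose n"
proof -
  let ?G = "{g \<in> {1..n} \<rightarrow>\<^sub>E {..<M}. strict_mono_on {1..n} (g :: nat \<Rightarrow> nat)}"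
  let ?S = "{A. A \<subseteq> {..<M} \<and> card A = n}"
  have "bij_betw (\<lambda>g. g ` {1..n}) ?G ?S"
    unfolding bij_betw_def
  proof
    show "inj_on (\<lambda>g. g ` {1..n}) ?G"
    proof (rule inj_onI)
      fix g h assume gh: "g \<in> ?G" "h \<in> ?G" "g ` {1..n} = h ` {1..n}"
      then have "g \<in> {1..n} \<rightarrow>\<^sub>E {..<M}" "h \<in> {1..n} \<rightarrow>\<^sub>E {..<M}" by auto
      then show "g = h"
      proof (rule PiE_ext)
        show "g i = h i" if "i \<in> {1..n}" for i
          using strict_mono_enumeration_unique[of n g h i] gh that by simp
      qed
    qed
    show "(\<lambda>g. g ` {1..n}) ` ?G = ?S"
    proof
      show "(\<lambda>g. g ` {1..n}) ` ?G \<subseteq> ?S"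
        by (auto simp: card_image strict_mono_on_imp_inj_on)
      show "?S \<subseteq> (\<lambda>g. g ` {1..n}) ` ?G"
      proof
        fix A assume "A \<in> ?S"
        then have A: "A \<subseteq> {..<M}" "card A = n" "finite A"
          by (auto intro: finite_subset)
        obtain g where g: "strict_mono_on {1..n} g" "g ` {1..n} = A"
          using strict_mono_enumeration[OF A(3,2)] by blast
        have "restrict g {1..n} \<in> ?G"
          using g A by (auto simp: strict_mono_on_def)
        moreover have "restrict g {1..n} ` {1..n} = A" using g by simp
        ultimately show "A \<in> (\<lambda>g. g ` {1..n}) ` ?G" by blast
      qed
    qed
  qed
  then show ?thesis by (simp add: bij_betw_same_card n_subsets)
qed

section \<open>Stable sorting of words\<close>

text \<open>Ties between equal letters are broken by position, so that every word has exactly one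
  sorting permutation.\<close>

definition stable_less :: "(nat \<Rightarrow> nat) \<Rightarrow> nat \<Rightarrow> nat \<Rightarrow> bool" where
  "stable_less w p q \<longleftrightarrow> w p < w q \<or> w p = w q \<and> p < q"

lemma transp_stable_less: "transp (\<lambda>i j. stable_less w (\<pi> i) (\<pi> j))"
  by (auto simp: stable_less_def intro!: transpI)

text \<open>The words over \<open>{..<a}\<close> whose stable sorting permutation is \<open>\<pi>\<close>.\<close>

definition sorted_by :: "nat \<Rightarrow> nat \<Rightarrow> (nat \<Rightarrow> nat) \<Rightarrow> (nat \<Rightarrow> nat) set" where
  "sorted_by n a \<pi> = {w \<in> {1..n} \<rightarrow>\<^sub>E {..<a}.
     \<forall>i\<in>{1..n}. \<forall>j\<in>{1..n}. i < j \<longrightarrow> stable_less w (\<pi> i) (\<pi> j)}"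

lemma finite_sorted_by: "finite (sorted_by n a \<pi>)"
  unfolding sorted_by_def by (rule finite_Collect_conjI) (auto intro: finite_PiE)

text \<open>The converse direction is asymmetry of \<open>stable_less\<close>. In radix sort it
  replaces a comparison of lower digits by one of positions.\<close>

lemma sorted_by_less_iff:
  assumes "w \<in> sorted_by n a \<pi>" "i \<in> {1..n}" "j \<in> {1..n}"
  shows "stable_less w (\<pi> i) (\<pi> j) \<longleftrightarrow> i < j"
proof (cases i j rule: linorder_cases)
  case greater
  then have "stable_less w (\<pi> j) (\<pi> i)" using assms by (auto simp: sorted_by_def)
  then show ?thesis using greater by (auto simp: stable_less_def)
qed (use assms in \<open>auto simp: sorted_by_def stable_less_def\<close>)

text \<open>An injective integer encoding of \<open>stable_less\<close>.\<close>

definition key :: "nat \<Rightarrow> (nat \<Rightarrow> nat) \<Rightarrow> nat \<Rightarrow> nat" where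
  "key n w p = w p * (n + 1) + p"

text \<open>A difference in the upper digit outweighs any lower digit below \<open>m\<close>. This
  serves with base \<open>n + 1\<close> for \<open>key\<close> and with base \<open>m\<close> for
  radix sort.\<close>

lemma digits_less_iff:
  fixes m :: nat
  assumes "r < m" "r' < m"
  shows "x * m + r < y * m + r' \<longleftrightarrow> x < y \<or> x = y \<and> r < r'"
proof -
  have step: "x * m + r < y * m + r'" if "x < y" "r < m" for x y r r' :: nat
  proof -
    have "x * m + r < (x + 1) * m" using that by simp
    also have "\<dots> \<le> y * m" using that by (intro mult_right_mono) auto
    finally show ?thesis by simp
  qed
  show ?thesis
    using step[of x y r r'] step[of y x r' r] assms by (cases x y rule: linorder_cases) auto
qed

lemma digits_eq_iff:
  fixes m :: nat
  assumes "r < m" "r' < m"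
  shows "x * m + r = y * m + r' \<longleftrightarrow> x = y \<and> r = r'"
  using digits_less_iff[OF assms, of x y] digits_less_iff[OF assms(2,1), of y x]
  by (auto simp: nat_neq_iff)

lemma key_less_iff:
  assumes "p \<in> {1..n}" "q \<in> {1..n}"
  shows "key n w p < key n w q \<longleftrightarrow> stable_less w p q"
  unfolding key_def stable_less_def using assms by (intro digits_less_iff) auto

lemma inj_on_key: "inj_on (key n w) {1..n}"
  unfolding key_def by (rule inj_onI) (subst (asm) digits_eq_iff, auto)

lemma strict_mono_on_key:
  assumes "w \<in> sorted_by n a \<pi>" "\<pi> permutes {1..n}"
  shows "strict_mono_on {1..n} (\<lambda>i. key n w (\<pi> i))"
proof (rule strict_mono_onI)
  fix r s assume "r \<in> {1..n}" "s \<in> {1..n}" "r < s"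
  moreover from this have "\<pi> r \<in> {1..n}" "\<pi> s \<in> {1..n}"
    using permutes_in_image[OF assms(2)] by blast+
  ultimately show "key n w (\<pi> r) < key n w (\<pi> s)"
    using assms(1) by (simp add: key_less_iff sorted_by_def)
qed

text \<open>Both permutations list the keys of \<open>w\<close> in increasing order, a finite set
  has only one such enumeration, and a key determines its position.\<close>

lemma sorted_by_unique:
  assumes w: "w \<in> sorted_by n a \<pi>" "w \<in> sorted_by n a \<sigma>"
    and perm: "\<pi> permutes {1..n}" "\<sigma> permutes {1..n}"
  shows "\<pi> = \<sigma>"
proof
  fix i
  have image: "(\<lambda>i. key n w (\<rho> i)) ` {1..n} = key n w ` {1..n}" if "\<rho> permutes {1..n}" for \<rho>
    using permutes_image[OF that] by (metis image_image)
  show "\<pi> i = \<sigma> i"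
  proof (cases "i \<in> {1..n}")
    case True
    have "key n w (\<pi> i) = key n w (\<sigma> i)"
      by (rule strict_mono_enumeration_unique[OF strict_mono_on_key[OF w(1) perm(1)]
            strict_mono_on_key[OF w(2) perm(2)] _ True])
         (simp only: image perm)
    then show ?thesis
      using True inj_on_key[of n w] permutes_in_image[OF perm(1), of i]
        permutes_in_image[OF perm(2), of i] by (meson inj_onD)
  next
    case False
    then show ?thesis using perm by (simp add: permutes_not_in)
  qed
qed

text \<open>The permutation arises by listing the \<open>n\<close> distinct keys in increasing order
  and pulling each one back to its position.\<close>

lemma sorted_by_exists:
  assumes "w \<in> {1..n} \<rightarrow>\<^sub>E {..<a}"
  obtains \<pi> where "\<pi> permutes {1..n}" "w \<in> sorted_by n a \<pi>"
proof -
  have "card (key n w ` {1..n}) = n" by (simp only: card_image[OF inj_on_key]) simp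
  then obtain g where g: "strict_mono_on {1..n} g" "g ` {1..n} = key n w ` {1..n}"
    using strict_mono_enumeration[of "key n w ` {1..n}" n] by auto
  have key: "bij_betw (key n w) {1..n} (key n w ` {1..n})"
    using inj_on_key by (rule inj_on_imp_bij_betw)
  have bij_g: "bij_betw g {1..n} (key n w ` {1..n})"
    using g by (simp add: bij_betw_def strict_mono_on_imp_inj_on)
  define \<pi> where "\<pi> = (\<lambda>i. if i \<in> {1..n} then the_inv_into {1..n} (key n w) (g i) else i)"
  have "bij_betw (the_inv_into {1..n} (key n w) \<circ> g) {1..n} {1..n}"
    using bij_betw_trans[OF bij_g bij_betw_the_inv_into[OF key]] .
  then have "bij_betw \<pi> {1..n} {1..n}"
    by (rule bij_betw_cong[THEN iffD1, rotated]) (simp add: \<pi>_def)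
  then have perm: "\<pi> permutes {1..n}"
    by (rule bij_imp_permutes) (auto simp: \<pi>_def)
  have key_\<pi>: "key n w (\<pi> i) = g i" if "i \<in> {1..n}" for i
  proof -
    have "g i \<in> key n w ` {1..n}" using that g(2) by blast
    then show ?thesis using that f_the_inv_into_f[OF inj_on_key] by (simp add: \<pi>_def)
  qed
  have "stable_less w (\<pi> i) (\<pi> j)" if "i \<in> {1..n}" "j \<in> {1..n}" "i < j" for i j
    using that g(1) key_\<pi> key_less_iff[of "\<pi> i" n "\<pi> j" w] permutes_in_image[OF perm]
    by (metis strict_mono_onD)
  with assms perm show ?thesis by (intro that) (auto simp: sorted_by_def)
qed

section \<open>Counting the words with a given sorting permutation\<close>

text \<open>Adding to \<open>w (\<pi> i)\<close> the number of non-descents of \<open>\<pi>\<close> before \<open>i\<close> turns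
  the words sorted by \<open>\<pi>\<close> into strictly increasing ones.\<close>

lemma card_sorted_by:
  assumes n: "n \<ge> 1" and perm: "\<pi> permutes {1..n}"
  shows "card (sorted_by n a \<pi>) = (a + n - 1 - des n \<pi>) choose n"
proof -
  define e where "e i = card {l \<in> {1..<i}. \<pi> l \<le> \<pi> (l + 1)}" for i
  have e_1: "e 1 = 0" by (simp add: e_def)
  have e_step: "e (i + 1) = e i + (if \<pi> i \<le> \<pi> (i + 1) then 1 else 0)" if "1 \<le> i" for i
  proof -
    have "{l \<in> {1..<i + 1}. \<pi> l \<le> \<pi> (l + 1)} =
        (if \<pi> i \<le> \<pi> (i + 1) then insert i {l \<in> {1..<i}. \<pi> l \<le> \<pi> (l + 1)}
         else {l \<in> {1..<i}. \<pi> l \<le> \<pi> (l + 1)})"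
      using that by (auto simp: less_Suc_eq)
    then show ?thesis by (simp add: e_def)
  qed
  have e_n: "e n + des n \<pi> = n - 1"
  proof -
    have "e n + des n \<pi> = card ({l \<in> {1..<n}. \<pi> l \<le> \<pi> (l + 1)} \<union> {l \<in> {1..n - 1}. \<pi> l > \<pi> (l + 1)})"
      unfolding e_def des_def by (subst card_Un_disjoint) auto
    also have "{l \<in> {1..<n}. \<pi> l \<le> \<pi> (l + 1)} \<union> {l \<in> {1..n - 1}. \<pi> l > \<pi> (l + 1)} = {1..<n}"
      by auto
    finally show ?thesis by simp
  qed
  define M where "M = a + n - 1 - des n \<pi>"
  \<comment> \<open>There are \<open>n - 1 - des n \<pi>\<close> non-descents in all, so the largest
    shift \<open>e n\<close> raises the bound \<open>a\<close> to exactly \<open>M\<close>.\<close>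
  have M: "M = a + e n" using e_n n by (simp add: M_def)
  let ?G = "{g \<in> {1..n} \<rightarrow>\<^sub>E {..<M}. strict_mono_on {1..n} (g :: nat \<Rightarrow> nat)}"
  define up where "up w = (\<lambda>i\<in>{1..n}. w (\<pi> i) + e i)" for w :: "nat \<Rightarrow> nat"
  define down where "down g = (\<lambda>p\<in>{1..n}. g (inv \<pi> p) - e (inv \<pi> p))" for g :: "nat \<Rightarrow> nat"
  have inv: "inv \<pi> (\<pi> i) = i" "\<pi> (inv \<pi> i) = i" for i
    using permutes_inverses[OF perm] by auto
  have in_n: "\<pi> i \<in> {1..n} \<longleftrightarrow> i \<in> {1..n}" "inv \<pi> i \<in> {1..n} \<longleftrightarrow> i \<in> {1..n}" for i
    using permutes_in_image[OF perm] permutes_in_image[OF permutes_inv[OF perm]] by auto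
  have e_mono: "e i \<le> e j" if "i \<le> j" for i j
    unfolding e_def using that by (intro card_mono) auto
  \<comment> \<open>This says that \<open>g - e\<close> is weakly increasing, in a form without
    subtraction: each step of \<open>g\<close> is at least \<open>1\<close>, each step of
    \<open>e\<close> at most \<open>1\<close>.\<close>
  have grow: "g i + e j \<le> g j + e i" if g: "g \<in> ?G" and ij: "1 \<le> i" "i \<le> j" "j \<le> n" for g i j
  proof (cases "i = j")
    case False
    show ?thesis
    proof (rule adjacent_imp_all[where R = "\<lambda>i j. g i + e j \<le> g j + e i" and a = 1 and b = n])
      show "transp (\<lambda>i j. g i + e j \<le> g j + e i)" by (rule transpI) linarith
      show "g i + e (i + 1) \<le> g (i + 1) + e i" if "1 \<le> i" "i < n" for i
        using g that strict_mono_onD[of "{1..n}" g i "i + 1"] by (auto simp: e_step simp del: One_nat_def)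
    qed (use ij False in auto)
  qed simp
  have e_le: "e i \<le> g i" if "g \<in> ?G" "i \<in> {1..n}" for g i
    using grow[OF that(1), of 1 i] that e_1 by simp
  have up_in: "up w \<in> ?G" if w: "w \<in> sorted_by n a \<pi>" for w
  proof -
    have "w (\<pi> i) + e i < M" if "i \<in> {1..n}" for i
    proof -
      have "w (\<pi> i) < a" using w in_n that by (auto simp: sorted_by_def)
      then show ?thesis using e_mono[of i n] that M by simp
    qed
    moreover have "w (\<pi> i) + e i < w (\<pi> j) + e j" if "1 \<le> i" "i < j" "j \<le> n" for i j
    proof (rule adjacent_imp_all[where a = 1 and b = n, OF _ _ that])
      show "transp (\<lambda>i j. w (\<pi> i) + e i < w (\<pi> j) + e j)" by (rule transpI) linarith
      show "w (\<pi> i) + e i < w (\<pi> (i + 1)) + e (i + 1)" if "1 \<le> i" "i < n" for i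
      proof -
        \<comment> \<open>At a descent the tie-breaker fails, so \<open>w\<close> must increase
          strictly; at a non-descent it increases weakly and \<open>e\<close> adds
          \<open>1\<close>.\<close>
        have "stable_less w (\<pi> i) (\<pi> (i + 1))" using w that by (simp add: sorted_by_def)
        then show ?thesis using e_step[OF that(1)] by (auto simp: stable_less_def)
      qed
    qed
    ultimately show ?thesis by (auto simp: up_def strict_mono_on_def)
  qed
  have down_in: "down g \<in> sorted_by n a \<pi>" if g: "g \<in> ?G" for g
  proof -
    have down_\<pi>: "down g (\<pi> i) = g i - e i" if "i \<in> {1..n}" for i
      using that in_n by (simp add: down_def inv)
    have "g i - e i < a" if i: "i \<in> {1..n}" for i
    proof -
      have "g n < M" using g n by auto
      moreover have "g i + e n \<le> g n + e i" using grow[OF g, of i n] i by simp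
      ultimately show ?thesis using e_le[OF g i] M by linarith
    qed
    then have "down g \<in> {1..n} \<rightarrow>\<^sub>E {..<a}"
      using in_n by (auto simp: down_def)
    moreover have "stable_less (down g) (\<pi> i) (\<pi> j)" if "1 \<le> i" "i < j" "j \<le> n" for i j
    proof (rule adjacent_imp_all[where a = 1 and b = n, OF transp_stable_less _ that])
      fix i assume i: "1 \<le> i" "i < n"
      then have "i \<in> {1..n}" "i + 1 \<in> {1..n}" by auto
      moreover have "g i < g (i + 1)"
        using g i strict_mono_onD[of "{1..n}" g i "i + 1"] by auto
      \<comment> \<open>Turns the weak inequality at a non-descent into the strict one that breaks
        ties.\<close>
      moreover have "\<pi> i \<noteq> \<pi> (i + 1)"
        using inv(1) by (metis n_not_Suc_n Suc_eq_plus1)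
      ultimately show "stable_less (down g) (\<pi> i) (\<pi> (i + 1))"
        using e_le[OF g, of i] e_le[OF g, of "i + 1"] e_step[OF i(1)]
        unfolding stable_less_def by (auto simp: down_\<pi> split: if_splits simp del: One_nat_def)
    qed
    ultimately show ?thesis by (simp add: sorted_by_def)
  qed
  have "bij_betw up (sorted_by n a \<pi>) ?G"
  proof (rule bij_betw_byWitness[where f' = down])
    show "\<forall>w\<in>sorted_by n a \<pi>. down (up w) = w"
    proof
      fix w assume "w \<in> sorted_by n a \<pi>"
      then have w: "w \<in> {1..n} \<rightarrow>\<^sub>E {..<a}" by (simp add: sorted_by_def)
      have "down (up w) p = w p" for p
        by (cases "p \<in> {1..n}")
           (simp_all only: up_def down_def inv in_n restrict_apply if_True if_False not_False_eq_True PiE_arb[OF w] add_diff_cancel_right')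
      then show "down (up w) = w" by (rule ext)
    qed
    show "\<forall>g\<in>?G. up (down g) = g"
    proof
      fix g assume g: "g \<in> ?G"
      show "up (down g) = g"
      proof
        fix i
        have g': "g \<in> {1..n} \<rightarrow>\<^sub>E {..<M}" using g by simp
        show "up (down g) i = g i"
          using e_le[OF g, of i]
          by (cases "i \<in> {1..n}")
             (simp_all only: up_def down_def inv in_n restrict_apply if_True if_False not_False_eq_True PiE_arb[OF g'] le_add_diff_inverse2)
      qed
    qed
  qed (use up_in down_in in blast)+
  then show ?thesis
    using card_strict_mono_functions[of n M] by (simp add: bij_betw_same_card M_def)
qed

section \<open>Radix sort and the product formula\<close>

text \<open>Sorting by \<open>w\<close> amounts to sorting stably by the lower digits of \<open>w\<close> to base \<open>m\<close> and then
  by the upper digits, as in radix sort.\<close>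

lemma card_sorted_by_mod:
  assumes \<sigma>: "\<sigma> permutes {1..n}" and \<pi>: "\<pi> permutes {1..n}"
  shows "card {w \<in> sorted_by n (m * k) \<pi>. (\<lambda>p\<in>{1..n}. w p mod m) \<in> sorted_by n m \<sigma>} =
    card (sorted_by n m \<sigma>) * card (sorted_by n k (inv \<sigma> \<circ> \<pi>))"
    (is "card ?L = _")
proof -
  \<comment> \<open>The lower digits \<open>u\<close> are indexed by original positions, the upper
    digits \<open>v\<close> by positions after the first pass; hence the
    \<open>inv \<sigma>\<close>.\<close>
  define enc where
    "enc = (\<lambda>(u, v). \<lambda>p\<in>{1..n}. v (inv \<sigma> p) * m + (u p :: nat))"
  define dec where
    "dec w = ((\<lambda>p\<in>{1..n}. w p mod m), (\<lambda>q\<in>{1..n}. w (\<sigma> q) div m))" for w :: "nat \<Rightarrow> nat"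
  let ?R = "sorted_by n m \<sigma> \<times> sorted_by n k (inv \<sigma> \<circ> \<pi>)"
  have inv: "inv \<sigma> (\<sigma> i) = i" "\<sigma> (inv \<sigma> i) = i" for i
    using permutes_inverses[OF \<sigma>] by auto
  have in_n: "\<sigma> i \<in> {1..n} \<longleftrightarrow> i \<in> {1..n}" "inv \<sigma> i \<in> {1..n} \<longleftrightarrow> i \<in> {1..n}"
      "\<pi> i \<in> {1..n} \<longleftrightarrow> i \<in> {1..n}" for i
    using permutes_in_image[OF \<sigma>] permutes_in_image[OF permutes_inv[OF \<sigma>]]
      permutes_in_image[OF \<pi>] by auto
  \<comment> \<open>After the pass by \<open>\<sigma>\<close>, the order of the lower digits is the
    order of positions, so it acts as tie-breaker for the upper digits.\<close>
  have less_iff: "stable_less w (\<sigma> q) (\<sigma> q') \<longleftrightarrow> stable_less v q q'"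
    if u: "u \<in> sorted_by n m \<sigma>" and q: "q \<in> {1..n}" "q' \<in> {1..n}"
      and w: "\<And>q. q \<in> {1..n} \<Longrightarrow> w (\<sigma> q) = v q * m + u (\<sigma> q)" for u v w q q'
  proof -
    have "u (\<sigma> q) < m" "u (\<sigma> q') < m"
      using u q in_n by (auto simp: sorted_by_def)
    then have "stable_less w (\<sigma> q) (\<sigma> q') \<longleftrightarrow>
        v q < v q' \<or> v q = v q' \<and> stable_less u (\<sigma> q) (\<sigma> q')"
      using q by (auto simp: stable_less_def w digits_less_iff digits_eq_iff)
    also have "\<dots> \<longleftrightarrow> stable_less v q q'"
      using sorted_by_less_iff[OF u q] by (simp add: stable_less_def)
    finally show ?thesis .
  qed
  have transfer: "(\<forall>i\<in>{1..n}. \<forall>j\<in>{1..n}. i < j \<longrightarrow> stable_less w (\<pi> i) (\<pi> j)) \<longleftrightarrow>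
      (\<forall>i\<in>{1..n}. \<forall>j\<in>{1..n}. i < j \<longrightarrow> stable_less v ((inv \<sigma> \<circ> \<pi>) i) ((inv \<sigma> \<circ> \<pi>) j))"
    if u: "u \<in> sorted_by n m \<sigma>" and w: "\<And>q. q \<in> {1..n} \<Longrightarrow> w (\<sigma> q) = v q * m + u (\<sigma> q)" for u v w
  proof -
    have "stable_less w (\<pi> i) (\<pi> j) \<longleftrightarrow> stable_less v ((inv \<sigma> \<circ> \<pi>) i) ((inv \<sigma> \<circ> \<pi>) j)"
      if "i \<in> {1..n}" "j \<in> {1..n}" for i j
      using less_iff[OF u _ _ w, of "inv \<sigma> (\<pi> i)" "inv \<sigma> (\<pi> j)"] that in_n by (simp add: inv)
    then show ?thesis by blast
  qed
  have "bij_betw enc ?R ?L"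
  proof (rule bij_betw_byWitness[where f' = dec])
    have dec_enc: "dec (enc (u, v)) = (u, v)" if uv: "(u, v) \<in> ?R" for u v
    proof -
      have "u \<in> {1..n} \<rightarrow>\<^sub>E {..<m}" "v \<in> {1..n} \<rightarrow>\<^sub>E {..<k}"
        using uv by (auto simp: sorted_by_def)
      then have u_less: "\<And>p. p \<in> {1..n} \<Longrightarrow> u p < m"
        and arb: "\<And>p. p \<notin> {1..n} \<Longrightarrow> u p = undefined \<and> v p = undefined"
        by (blast dest: PiE_mem PiE_arb)+
      have "fst (dec (enc (u, v))) p = u p" for p
        using u_less arb by (cases "p \<in> {1..n}") (simp_all add: enc_def dec_def del: atLeastAtMost_iff)
      moreover have "snd (dec (enc (u, v))) p = v p" for p
      proof (cases "p \<in> {1..n}")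
        case True
        then have "snd (dec (enc (u, v))) p = (v p * m + u (\<sigma> p)) div m"
          by (simp only: enc_def dec_def snd_conv prod.case restrict_apply in_n inv if_True)
        also have "\<dots> = v p" using u_less[of "\<sigma> p"] in_n(1)[of p] True by simp
        finally show ?thesis .
      qed (use arb in \<open>simp add: dec_def del: atLeastAtMost_iff\<close>)
      ultimately show ?thesis by (intro prod_eqI ext) simp_all
    qed
    then show "\<forall>x\<in>?R. dec (enc x) = x" by auto
    show "\<forall>w\<in>?L. enc (dec w) = w"
    proof
      fix w assume "w \<in> ?L"
      then have w: "w \<in> {1..n} \<rightarrow>\<^sub>E {..<m * k}" by (simp add: sorted_by_def)
      have "enc (dec w) p = w p" for p
        by (cases "p \<in> {1..n}")
           (simp_all only: enc_def dec_def prod.case restrict_apply in_n inv if_True if_False not_False_eq_True PiE_arb[OF w] div_mult_mod_eq)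
      then show "enc (dec w) = w" by (rule ext)
    qed
    show "enc ` ?R \<subseteq> ?L"
    proof (rule image_subsetI)
      fix x assume "x \<in> ?R"
      then obtain u v where x: "x = (u, v)"
        and u: "u \<in> sorted_by n m \<sigma>" and v: "v \<in> sorted_by n k (inv \<sigma> \<circ> \<pi>)" by blast
      define w where "w = enc (u, v)"
      have w_nth: "w (\<sigma> q) = v q * m + u (\<sigma> q)" if "q \<in> {1..n}" for q
        using that in_n by (simp add: w_def enc_def inv)
      have "v (inv \<sigma> p) * m + u p < m * k" if "p \<in> {1..n}" for p
      proof -
        have "v (inv \<sigma> p) < k" "u p < m"
          using u v that in_n by (auto simp: sorted_by_def)
        \<comment> \<open>The bound \<open>m * k\<close> is read as upper digit \<open>k\<close>
          with lower digit \<open>0\<close>.\<close>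
        then show ?thesis
          using digits_less_iff[of "u p" m 0 "v (inv \<sigma> p)" k] by (simp add: mult.commute)
      qed
      then have "w \<in> {1..n} \<rightarrow>\<^sub>E {..<m * k}" by (auto simp: w_def enc_def)
      moreover have "\<forall>i\<in>{1..n}. \<forall>j\<in>{1..n}. i < j \<longrightarrow> stable_less w (\<pi> i) (\<pi> j)"
        using transfer[OF u w_nth] v by (simp add: sorted_by_def)
      moreover have "(\<lambda>p\<in>{1..n}. w p mod m) = u"
        using dec_enc[of u v] u v by (simp add: w_def dec_def)
      ultimately have "w \<in> sorted_by n (m * k) \<pi>" "(\<lambda>p\<in>{1..n}. w p mod m) \<in> sorted_by n m \<sigma>"
        using u by (simp_all only: sorted_by_def[of n "m * k"] mem_Collect_eq simp_thms)
      then show "enc x \<in> ?L" unfolding w_def x by blast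
    qed
    show "dec ` ?L \<subseteq> ?R"
    proof (rule image_subsetI)
      fix w assume "w \<in> ?L"
      then have w: "w \<in> sorted_by n (m * k) \<pi>"
        and u': "(\<lambda>p\<in>{1..n}. w p mod m) \<in> sorted_by n m \<sigma>" by auto
      define u where "u = (\<lambda>p\<in>{1..n}. w p mod m)"
      define v where "v = (\<lambda>q\<in>{1..n}. w (\<sigma> q) div m)"
      have u: "u \<in> sorted_by n m \<sigma>" using u' by (simp only: u_def)
      have w_nth: "w (\<sigma> q) = v q * m + u (\<sigma> q)" if "q \<in> {1..n}" for q
        using that by (simp only: u_def v_def restrict_apply in_n if_True div_mult_mod_eq)
      have "w p div m < k" if "p \<in> {1..n}" for p
      proof -
        have "w p < m * k" using w that by (auto simp: sorted_by_def)
        then show ?thesis by (simp add: less_mult_imp_div_less mult.commute)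
      qed
      then have "v \<in> {1..n} \<rightarrow>\<^sub>E {..<k}"
        using in_n(1) unfolding v_def by (intro restrict_PiE_iff[THEN iffD2]) blast
      moreover have "\<forall>i\<in>{1..n}. \<forall>j\<in>{1..n}. i < j \<longrightarrow>
          stable_less v ((inv \<sigma> \<circ> \<pi>) i) ((inv \<sigma> \<circ> \<pi>) j)"
        using transfer[OF u w_nth] w by (simp add: sorted_by_def)
      ultimately have "v \<in> sorted_by n k (inv \<sigma> \<circ> \<pi>)"
        unfolding sorted_by_def by blast
      then show "dec w \<in> ?R" using u by (simp only: dec_def u_def v_def mem_Times_iff fst_conv snd_conv simp_thms)
    qed
  qed
  then show ?thesis by (simp add: bij_betw_same_card[symmetric] card_cartesian_product)
qed

text \<open>The words sorted by \<open>\<pi>\<close> are classified by the unique permutation that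
  stably sorts their residues modulo \<open>m\<close>.\<close>

lemma sum_card_sorted_by:
  assumes \<pi>: "\<pi> permutes {1..n}" and m: "m \<ge> 1"
  shows "(\<Sum>\<sigma> | \<sigma> permutes {1..n}. card (sorted_by n m \<sigma>) * card (sorted_by n k (inv \<sigma> \<circ> \<pi>))) =
    card (sorted_by n (m * k) \<pi>)"
proof -
  define L where
    "L \<sigma> = {w \<in> sorted_by n (m * k) \<pi>. (\<lambda>p\<in>{1..n}. w p mod m) \<in> sorted_by n m \<sigma>}" for \<sigma>
  have "sorted_by n (m * k) \<pi> = (\<Union>\<sigma>\<in>{\<sigma>. \<sigma> permutes {1..n}}. L \<sigma>)"
  proof
    show "sorted_by n (m * k) \<pi> \<subseteq> (\<Union>\<sigma>\<in>{\<sigma>. \<sigma> permutes {1..n}}. L \<sigma>)"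
    proof
      fix w assume w: "w \<in> sorted_by n (m * k) \<pi>"
      have "(\<lambda>p\<in>{1..n}. w p mod m) \<in> {1..n} \<rightarrow>\<^sub>E {..<m}" using m by auto
      then obtain \<sigma> where "\<sigma> permutes {1..n}" "(\<lambda>p\<in>{1..n}. w p mod m) \<in> sorted_by n m \<sigma>"
        by (rule sorted_by_exists)
      with w show "w \<in> (\<Union>\<sigma>\<in>{\<sigma>. \<sigma> permutes {1..n}}. L \<sigma>)" by (auto simp: L_def)
    qed
  qed (auto simp: L_def)
  moreover have "card (\<Union>\<sigma>\<in>{\<sigma>. \<sigma> permutes {1..n}}. L \<sigma>) = (\<Sum>\<sigma> | \<sigma> permutes {1..n}. card (L \<sigma>))"
    by (rule card_UN_disjoint)
       (auto simp: finite_permutations L_def finite_sorted_by dest: sorted_by_unique)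
  moreover have "card (L \<sigma>) = card (sorted_by n m \<sigma>) * card (sorted_by n k (inv \<sigma> \<circ> \<pi>))"
    if "\<sigma> permutes {1..n}" for \<sigma>
    unfolding L_def using card_sorted_by_mod[OF that \<pi>] .
  ultimately show ?thesis by simp
qed

text \<open>This is \<open>\<Phi>(m) \<Phi>(k) = \<Phi>(m k)\<close> at the coefficient of
  \<open>\<pi>\<close>.\<close>

lemma sum_binomial_des:
  assumes n: "n \<ge> 1" and \<pi>: "\<pi> permutes {1..n}" and m: "m \<ge> 1"
  shows "(\<Sum>\<sigma> | \<sigma> permutes {1..n}.
      ((m + n - 1 - des n \<sigma>) choose n) * ((k + n - 1 - des n (inv \<sigma> \<circ> \<pi>)) choose n)) =
    (m * k + n - 1 - des n \<pi>) choose n"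
proof -
  have "inv \<sigma> \<circ> \<pi> permutes {1..n}" if "\<sigma> permutes {1..n}" for \<sigma>
    using permutes_compose[OF \<pi> permutes_inv[OF that]] .
  then show ?thesis
    using sum_card_sorted_by[OF \<pi> m, of k] n \<pi> by (simp add: card_sorted_by)
qed

section \<open>Rotations and cyclic descents\<close>

text \<open>Composition with this cycle on the right rotates one-line notation. Points outside
  \<open>{1..n}\<close> are fixed, as \<open>permutes\<close> demands.\<close>

definition rot :: "nat \<Rightarrow> nat \<Rightarrow> nat" where
  "rot n i = (if i \<in> {1..n} then if i = n then 1 else i + 1 else i)"

lemma cdes_rot: "cdes n \<pi> = card {i \<in> {1..n}. \<pi> i > \<pi> (rot n i)}"
  unfolding cdes_def rot_def by (rule arg_cong[where f = card]) auto

lemma rot_permutes: "rot n permutes {1..n}"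
proof (rule bij_imp_permutes)
  have "inj_on (rot n) {1..n}" by (auto simp: inj_on_def rot_def split: if_splits)
  moreover have "rot n ` {1..n} \<subseteq> {1..n}" by (auto simp: rot_def split: if_splits)
  ultimately show "bij_betw (rot n) {1..n} {1..n}"
    by (simp add: bij_betw_def endo_inj_surj)
qed (simp only: rot_def if_False)

lemma rot_funpow_permutes: "rot n ^^ r permutes {1..n}"
proof (induction r)
  case (Suc r)
  then show ?case using permutes_compose[OF Suc rot_permutes] by (simp only: funpow.simps)
qed (simp only: funpow.simps permutes_id)

text \<open>Locates the break of the \<open>r\<close>-th rotation: \<open>r\<close> comes last, so
  the cyclic pair from \<open>r\<close> to \<open>rot n r\<close> is cut open.\<close>

lemma rot_funpow_last:
  assumes "r \<in> {1..n}"
  shows "(rot n ^^ r) n = r"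
proof -
  have "1 \<le> r \<Longrightarrow> r \<le> n \<Longrightarrow> (rot n ^^ r) n = r"
  proof (induction r)
    case (Suc r)
    then show ?case by (cases "r = 0") (auto simp: rot_def)
  qed simp
  then show ?thesis using assms by simp
qed

text \<open>Powers of \<open>rot n\<close> commute with \<open>rot n\<close>, so they permute the
  cyclically adjacent pairs.\<close>

lemma cdes_rot_funpow: "cdes n (\<pi> \<circ> rot n ^^ r) = cdes n \<pi>"
proof -
  let ?\<rho> = "rot n ^^ r"
  have bij: "bij_betw ?\<rho> {1..n} {1..n}"
    using permutes_imp_bij[OF rot_funpow_permutes] .
  have "bij_betw ?\<rho> {i \<in> {1..n}. \<pi> (?\<rho> i) > \<pi> (?\<rho> (rot n i))} {i \<in> {1..n}. \<pi> i > \<pi> (rot n i)}"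
    by (rule bij_betw_Collect[OF bij]) (simp add: funpow_swap1)
  then show ?thesis by (simp add: cdes_rot bij_betw_same_card)
qed

lemma cdes_eq_des:
  assumes "n \<ge> 1"
  shows "cdes n \<pi> = des n \<pi> + (if \<pi> n > \<pi> 1 then 1 else 0)"
proof -
  have "{i \<in> {1..n}. \<pi> i > (if i = n then \<pi> 1 else \<pi> (i + 1))} =
      {i \<in> {1..n - 1}. \<pi> i > \<pi> (i + 1)} \<union> (if \<pi> n > \<pi> 1 then {n} else {})"
    using assms by (auto simp: le_less split: if_splits)
  then show ?thesis
    unfolding cdes_def des_def using assms by (auto simp: card_insert_if)
qed

text \<open>This is \<open>\<Phi>(k) \<Omega> = k C(k)\<close> at the coefficient of
  \<open>\<pi>\<close>. A rotation that breaks a cyclic descent has one descent less; Pascal's rule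
  splits off its surplus \<open>N choose l\<close>.\<close>

lemma sum_binomial_rot:
  assumes n: "n \<ge> 1" and \<pi>: "\<pi> permutes {1..n}"
  shows "(\<Sum>r = 1..n. (k + n - 1 - des n (\<pi> \<circ> rot n ^^ r)) choose n) =
    k * ((k + n - 1 - cdes n \<pi>) choose (n - 1))"
proof -
  define N where "N = k + n - 1 - cdes n \<pi>"
  obtain l where l: "n = Suc l" using n by (cases n) auto
  have N: "N + cdes n \<pi> = k + l" using cdes_le[OF \<pi> n] l by (simp add: N_def)
  have summand: "(k + n - 1 - des n (\<pi> \<circ> rot n ^^ r)) choose n =
      (N choose n) + (if \<pi> r > \<pi> (rot n r) then N choose l else 0)" if r: "r \<in> {1..n}" for r
  proof -
    have "(rot n ^^ r) 1 = (rot n ^^ r) (rot n n)" using n by (simp add: rot_def)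
    also have "\<dots> = rot n r" using rot_funpow_last[OF r] by (simp flip: funpow_swap1)
    finally have "cdes n \<pi> = des n (\<pi> \<circ> rot n ^^ r) + (if \<pi> r > \<pi> (rot n r) then 1 else 0)"
      using cdes_eq_des[OF n, of "\<pi> \<circ> rot n ^^ r"] rot_funpow_last[OF r]
      by (simp add: cdes_rot_funpow)
    then have "k + n - 1 - des n (\<pi> \<circ> rot n ^^ r) = N + (if \<pi> r > \<pi> (rot n r) then 1 else 0)"
      using N l by (auto split: if_splits)
    then show ?thesis by (simp add: l)
  qed
  have "(\<Sum>r = 1..n. (k + n - 1 - des n (\<pi> \<circ> rot n ^^ r)) choose n) =
      n * (N choose n) + cdes n \<pi> * (N choose l)"
  proof -
    have "(\<Sum>r = 1..n. if \<pi> r > \<pi> (rot n r) then N choose l else 0) = cdes n \<pi> * (N choose l)"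
      by (simp add: cdes_rot sum.If_cases Int_def flip: sum.inter_filter)
    then show ?thesis
      by (simp only: sum.cong[OF refl summand] sum.distrib) simp
  qed
  also have "\<dots> = k * (N choose l)"
  \<comment> \<open>The factor \<open>N - l + cdes n \<pi>\<close> is \<open>k\<close> if the
    subtraction is not truncated; for \<open>N < l\<close> both binomials vanish.\<close>
  proof (cases "l \<le> N")
    case True
    have "n * (N choose n) = (N - l) * (N choose l)"
      by (simp only: l binomial_absorption binomial_absorb_comp)
    then have "n * (N choose n) + cdes n \<pi> * (N choose l) = (N - l + cdes n \<pi>) * (N choose l)"
      by (simp add: algebra_simps)
    also have "N - l + cdes n \<pi> = k" using N True by simp
    finally show ?thesis .
  qed (simp add: l binomial_eq_0)
  finally show ?thesis by (simp add: N_def l)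
qed

text \<open>Both sides are multiplied by \<open>k\<close>, so \<open>k = 0\<close> is treated separately; there both sides
  vanish for \<open>n \<ge> 2\<close> because every permutation then has a cyclic descent.\<close>

lemma sum_binomial_des_cdes:
  assumes n: "n \<ge> 1" and \<pi>: "\<pi> permutes {1..n}" and m: "m \<ge> 1"
  shows "(\<Sum>\<sigma> | \<sigma> permutes {1..n}.
      ((m + n - 1 - des n \<sigma>) choose n) * ((k + n - 1 - cdes n (inv \<sigma> \<circ> \<pi>)) choose (n - 1))) =
    m * ((m * k + n - 1 - cdes n \<pi>) choose (n - 1))"
    (is "?S = ?R")
proof -
  have perm: "inv \<sigma> \<circ> \<pi> permutes {1..n}" if "\<sigma> permutes {1..n}" for \<sigma>
    using permutes_compose[OF \<pi> permutes_inv[OF that]] .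
  have "k * ?S = (\<Sum>\<sigma> | \<sigma> permutes {1..n}. ((m + n - 1 - des n \<sigma>) choose n) *
      (k * ((k + n - 1 - cdes n (inv \<sigma> \<circ> \<pi>)) choose (n - 1))))"
    by (simp add: sum_distrib_left mult_ac)
  also have "\<dots> = (\<Sum>\<sigma> | \<sigma> permutes {1..n}. ((m + n - 1 - des n \<sigma>) choose n) *
      (\<Sum>r = 1..n. (k + n - 1 - des n (inv \<sigma> \<circ> \<pi> \<circ> rot n ^^ r)) choose n))"
    by (intro sum.cong refl) (simp only: mem_Collect_eq sum_binomial_rot[OF n perm])
  \<comment> \<open>Reassociation moves the rotation onto \<open>\<pi>\<close>, so that for fixed
    \<open>r\<close> the inner sum is an instance of the product formula.\<close>
  also have "\<dots> = (\<Sum>r = 1..n. \<Sum>\<sigma> | \<sigma> permutes {1..n}. ((m + n - 1 - des n \<sigma>) choose n) *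
      ((k + n - 1 - des n (inv \<sigma> \<circ> (\<pi> \<circ> rot n ^^ r))) choose n))"
    unfolding sum_distrib_left by (subst sum.swap) (simp add: comp_assoc)
  also have "\<dots> = (\<Sum>r = 1..n. (m * k + n - 1 - des n (\<pi> \<circ> rot n ^^ r)) choose n)"
    by (simp only: sum_binomial_des[OF n permutes_compose[OF rot_funpow_permutes \<pi>] m])
  also have "\<dots> = k * ?R"
    by (simp only: sum_binomial_rot[OF n \<pi>]) simp
  finally have k_times: "k * ?S = k * ?R" .
  show ?thesis
  proof (cases "k = 0")
    case False
    then show ?thesis using k_times by simp
  next
    case k: True
    show ?thesis
    proof (cases "n = 1")
      case True
      then have "{\<sigma>. \<sigma> permutes {1..n}} = {id}" by auto
      then show ?thesis using True \<pi> by (simp add: des_def)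
    next
      case False
      have "(n - 1 - cdes n \<rho>) choose (n - 1) = 0" if \<rho>: "\<rho> permutes {1..n}" for \<rho>
      proof -
        \<comment> \<open>The position of the maximum is a cyclic descent once its cyclic successor
          is a different position.\<close>
        obtain i where i: "i \<in> {1..n}" "\<rho> i = n"
          using permutes_image[OF \<rho>] n by (metis atLeastAtMost_iff imageE order_refl)
        have rot: "rot n i \<in> {1..n}" "rot n i \<noteq> i"
          using i(1) False by (auto simp: rot_def)
        then have "\<rho> (rot n i) \<in> {1..n}" "\<rho> (rot n i) \<noteq> \<rho> i"
          using permutes_in_image[OF \<rho>] permutes_inj[OF \<rho>] by (auto dest: injD)
        then have "i \<in> {i \<in> {1..n}. \<rho> i > \<rho> (rot n i)}" using i by auto
        then have "cdes n \<rho> > 0" unfolding cdes_rot by (subst card_gt_0_iff) auto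
        then show ?thesis using False n by simp
      qed
      then show ?thesis using k \<pi> perm by (simp del: binomial_eq_0_iff One_nat_def)
    qed
  qed
qed

section \<open>Binomial series in one and two variables\<close>

text \<open>By Pascal's rule, multiplication by \<open>1 - fps_X\<close> lowers \<open>n\<close> by
  one. The general ring covers both \<open>s\<close>, with coefficients in \<open>rat fps\<close>,
  and \<open>t\<close>, with coefficients in \<open>rat\<close>.\<close>

lemma binomial_series_mult:
  "Abs_fps (\<lambda>j. of_nat ((j + n) choose n)) * (1 - fps_X) ^ (n + 1) = (1 :: 'a :: comm_ring_1 fps)"
proof (induction n)
  case 0
  show ?case by (rule fps_ext) (auto simp: algebra_simps)
next
  case (Suc n)
  have "Abs_fps (\<lambda>j. of_nat ((j + Suc n) choose Suc n)) * (1 - fps_X) =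
      (Abs_fps (\<lambda>j. of_nat ((j + n) choose n)) :: 'a fps)"
  proof (rule fps_ext)
    fix j
    show "fps_nth (Abs_fps (\<lambda>j. of_nat ((j + Suc n) choose Suc n)) * (1 - fps_X)) j =
        fps_nth (Abs_fps (\<lambda>j. of_nat ((j + n) choose n)) :: 'a fps) j"
      by (cases j) (simp_all add: algebra_simps binomial_eq_0)
  qed
  then show ?case using Suc by (simp add: mult.assoc[symmetric] del: binomial_Suc_Suc)
qed

text \<open>For \<open>j < c\<close> the upper entry \<open>j + n - c\<close> is below
  \<open>n\<close>, so the first \<open>c\<close> coefficients vanish and the series is a shift by
  \<open>c\<close>.\<close>

lemma shifted_binomial_series_mult:
  assumes "c \<le> n"
  shows "Abs_fps (\<lambda>j. of_nat ((j + n - c) choose n)) * (1 - fps_X) ^ (n + 1) =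
    (fps_X ^ c :: 'a :: comm_ring_1 fps)"
proof -
  have "Abs_fps (\<lambda>j. of_nat ((j + n - c) choose n)) =
      fps_X ^ c * (Abs_fps (\<lambda>j. of_nat ((j + n) choose n)) :: 'a fps)"
    using assms by (intro fps_ext) (auto simp: fps_X_power_mult_nth binomial_eq_0)
  then show ?thesis
    by (simp only: mult.assoc binomial_series_mult mult_1_right)
qed

lemma fps2_product:
  "fps2 (\<lambda>j k. of_nat (a j) * of_nat (b k)) =
    Abs_fps (\<lambda>j. of_nat (a j)) * fps_const (Abs_fps (\<lambda>k. of_nat (b k)))"
  by (intro fps_ext) (simp add: fps2_def fps_of_nat[symmetric])

text \<open>The coefficients have product form, so each variable meets its own factor of the
  denominator; for \<open>t\<close> the one-variable identity is used with \<open>n - 1\<close> in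
  place of \<open>n\<close>.\<close>

lemma fps2_binomials_mult:
  assumes "n \<ge> 1" "c \<le> n" "d \<le> n - 1"
  shows "fps2 (\<lambda>j k. of_nat ((j + n - c) choose n) * of_nat ((k + n - 1 - d) choose (n - 1))) *
    ((1 - var_s) ^ (n + 1) * (1 - var_t) ^ n) = var_s ^ c * var_t ^ d"
proof -
  have "fps_const (Abs_fps (\<lambda>k. of_nat ((k + n - 1 - d) choose (n - 1)))) * (1 - var_t) ^ n =
      fps_const (Abs_fps (\<lambda>k. of_nat ((k + (n - 1) - d) choose (n - 1))) * (1 - fps_X) ^ (n - 1 + 1))"
    using assms(1) by (simp add: var_t_def fps_const_power flip: fps_const_1_eq_1)
  also have "\<dots> = var_t ^ d"
    using assms(3) by (subst shifted_binomial_series_mult) (auto simp: var_t_def fps_const_power)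
  finally have t: "fps_const (Abs_fps (\<lambda>k. of_nat ((k + n - 1 - d) choose (n - 1)))) * (1 - var_t) ^ n =
    var_t ^ d" .
  show ?thesis
    unfolding fps2_product t[symmetric] var_s_def shifted_binomial_series_mult[OF assms(2), symmetric]
    by (simp only: mult_ac)
qed

theorem theorem1p5p6:
  fixes n :: nat and \<pi> :: "nat \<Rightarrow> nat"
  assumes "n \<ge> 1" and "\<pi> permutes {1..n}"
  shows "fps2 (\<lambda>j k. of_nat ((j + 1) * (((j + 1) * k + n - 1 - cdes n \<pi>) choose (n - 1)))) =
    (\<Sum>(\<sigma>, \<tau>) | \<sigma> permutes {1..n} \<and> \<tau> permutes {1..n} \<and> \<sigma> \<circ> \<tau> = \<pi>.
       var_s ^ des n \<sigma> * var_t ^ cdes n \<tau>) /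
    ((1 - var_s) ^ (n + 1) * (1 - var_t) ^ n)"
proof (subst fps2_divide_eq_iff[OF denominator_constant_term])
  let ?D = "(1 - var_s) ^ (n + 1) * (1 - var_t) ^ n"
  let ?P = "{(\<sigma>, \<tau>). \<sigma> permutes {1..n} \<and> \<tau> permutes {1..n} \<and> \<sigma> \<circ> \<tau> = \<pi>}"
  \<comment> \<open>The expansion of one term of the numerator over \<open>?D\<close>;
    \<open>j + n\<close> is \<open>m + n - 1\<close> for \<open>m = j + 1\<close>.\<close>
  define summand where "summand \<sigma> = fps2 (\<lambda>j k. of_nat ((j + n - des n \<sigma>) choose n) *
      of_nat ((k + n - 1 - cdes n (inv \<sigma> \<circ> \<pi>)) choose (n - 1)))" for \<sigma>
  have perm: "inv \<sigma> \<circ> \<pi> permutes {1..n}" if "\<sigma> permutes {1..n}" for \<sigma>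
    using permutes_compose[OF assms(2) permutes_inv[OF that]] .
  \<comment> \<open>A factorization of \<open>\<pi>\<close> is determined by its left factor, which
    may be any permutation.\<close>
  have "bij_betw (\<lambda>\<sigma>. (\<sigma>, inv \<sigma> \<circ> \<pi>)) {\<sigma>. \<sigma> permutes {1..n}} ?P"
  proof (rule bij_betw_byWitness[where f' = fst])
    show "(\<lambda>\<sigma>. (\<sigma>, inv \<sigma> \<circ> \<pi>)) ` {\<sigma>. \<sigma> permutes {1..n}} \<subseteq> ?P"
      using perm by (auto simp: permutes_inv_o comp_assoc[symmetric])
    show "\<forall>x\<in>?P. (fst x, inv (fst x) \<circ> \<pi>) = x"
      by (auto simp: permutes_inv_o comp_assoc[symmetric])
  qed auto
  then have reindex: "(\<Sum>(\<sigma>, \<tau>)\<in>?P. var_s ^ des n \<sigma> * var_t ^ cdes n \<tau>) =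
      (\<Sum>\<sigma> | \<sigma> permutes {1..n}. var_s ^ des n \<sigma> * var_t ^ cdes n (inv \<sigma> \<circ> \<pi>))"
    by (subst sum.reindex_bij_betw[symmetric]) auto
  have "fps2 (\<lambda>j k. of_nat ((j + 1) * (((j + 1) * k + n - 1 - cdes n \<pi>) choose (n - 1)))) =
      (\<Sum>\<sigma> | \<sigma> permutes {1..n}. summand \<sigma>)"
  proof (intro fps_ext)
    fix j k
    \<comment> \<open>This is \<open>\<Phi>(m) C(k) = m C(m k)\<close> with
      \<open>m = j + 1\<close>, at the coefficient of \<open>\<pi>\<close>.\<close>
    have "of_nat ((j + 1) * (((j + 1) * k + n - 1 - cdes n \<pi>) choose (n - 1))) =
        (\<Sum>\<sigma> | \<sigma> permutes {1..n}. of_nat ((j + n - des n \<sigma>) choose n) *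
          (of_nat ((k + n - 1 - cdes n (inv \<sigma> \<circ> \<pi>)) choose (n - 1)) :: rat))"
      using arg_cong[OF sum_binomial_des_cdes[OF assms, of "j + 1" k, symmetric], of "of_nat :: nat \<Rightarrow> rat"]
      by (simp only: of_nat_sum of_nat_mult) simp
    then show "fps_nth (fps_nth (fps2 (\<lambda>j k. of_nat ((j + 1) *
          (((j + 1) * k + n - 1 - cdes n \<pi>) choose (n - 1))))) j) k =
        fps_nth (fps_nth (\<Sum>\<sigma> | \<sigma> permutes {1..n}. summand \<sigma>) j) k"
      by (simp only: fps2_def summand_def fps_sum_nth fps_nth_Abs_fps)
  qed
  moreover have "summand \<sigma> * ?D = var_s ^ des n \<sigma> * var_t ^ cdes n (inv \<sigma> \<circ> \<pi>)"
    if "\<sigma> permutes {1..n}" for \<sigma>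
  proof -
    have "cdes n \<sigma> \<le> n - 1" using cdes_le[OF that assms(1)] .
    then have "des n \<sigma> \<le> n" using cdes_eq_des[OF assms(1), of \<sigma>] by simp
    then show ?thesis
      unfolding summand_def by (rule fps2_binomials_mult[OF assms(1) _ cdes_le[OF perm[OF that] assms(1)]])
  qed
  ultimately show "fps2 (\<lambda>j k. of_nat ((j + 1) * (((j + 1) * k + n - 1 - cdes n \<pi>) choose (n - 1)))) * ?D =
      (\<Sum>(\<sigma>, \<tau>)\<in>?P. var_s ^ des n \<sigma> * var_t ^ cdes n \<tau>)"
    unfolding reindex by (simp add: sum_distrib_right)
qed

end
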